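(* Let $p_{Y|X}$ be a symmetric discrete-time memoryless channel with finite input alphabet $\mathcal X$ and finite output alphabet $\mathcal Y$, and let $p_X$ be a source (channel input) distribution on $\mathcal X$. Let $I(p_X)=I(X;Y)$ be the mutual information between the channel input $X\sim p_X$ and the channel output $Y$. For $\gamma\in[0,1]$ define $$E_{Fc}(\gamma, p_X)=\max_{0\le r_o\le 1} E_{Fc}(\gamma, p_X, r_o),$$ $$E_{Fc}(\gamma, p_X, r_o)=\max_{0\le \rho\le 1} (1-r_o)I(p_X) \left( -\rho \frac{\gamma}{r_o} + \frac{E_0(\rho, p_X)}{I(p_X)}\left[1 -\frac{1+r_o}{2}E_0(\rho, p_X)\right] \right),$$ $$E_{Fcs}(\gamma, p_X)=E_{Fc}\left(\gamma, p_X, r_o=\frac{\sqrt{\gamma^2+8\gamma}-\gamma}{2}\right),$$ where $$E_0(\rho, p_X)=-\log\sum_{y\in\mathcal Y} \left( \sum_{x\in\mathcal X} p_X(x)\,p_{Y|X}(y|x)^{\frac{1}{1+\rho}}\right)^{1+\rho}.$$ Then $$\lim_{\gamma \to 1} \frac{E_{Fcs}\left(\gamma, p_X\right)}{E_{Fc}(\gamma, p_X)}=1.$$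
   Context: All logarithms are natural. The parameter $\gamma\in[0,1]$ is the normalized fountain rate: the transmitter and receiver agree on the fountain information rate $\gamma I(p_X)$, where the fountain rate is the logarithm of the number of messages divided by the number of received channel symbols at which decoding takes place. The parameter $r_o$ is the rate of the outer code in a one-level concatenated fountain code (a near maximum-distance-separable outer code combined with random fountain inner codes whose symbols are i.i.d. with distribution $p_X$). $E_{Fc}(\gamma,p_X)$ is the error exponent with the optimal outer code rate, which requires knowing the channel at the transmitter; $E_{Fcs}(\gamma,p_X)$ is the exponent with the outer code rate $r_o=(\sqrt{\gamma^2+8\gamma}-\gamma)/2$, which depends only on $\gamma$. *)

theory Defs
  imports
    "HOL-Probability.Probability"
    "HOL-Combinatorics.Permutations"
    "HOL-Library.Disjoint_Sets"
begin

text \<open>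
  A discrete memoryless channel is given by its single-letter transition law
  \<open>W :: 'x \<Rightarrow> 'y pmf\<close>, with \<open>pmf (W x) y\<close> the probability of output \<open>y\<close> on input \<open>x\<close>.
  The alphabets are the finite types \<open>'x\<close> and \<open>'y\<close>.
\<close>

text \<open>
  Symmetry in the sense of Gallager: the output alphabet splits into blocks such that, within
  the transition matrix restricted to the columns of one block, all rows are permutations of
  each other and all columns are permutations of each other.
\<close>

definition symmetric_channel :: "('x::finite \<Rightarrow> 'y::finite pmf) \<Rightarrow> bool" where
  "symmetric_channel W \<longleftrightarrow>
     (\<exists>P. partition_on (UNIV :: 'y set) P \<and>
       (\<forall>B\<in>P.
         (\<forall>x x'. \<exists>\<sigma>. \<sigma> permutes B \<and> (\<forall>y\<in>B. pmf (W x') y = pmf (W x) (\<sigma> y))) \<and>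
         (\<forall>y\<in>B. \<forall>y'\<in>B. \<exists>\<pi>. \<pi> permutes (UNIV :: 'x set) \<and>
            (\<forall>x. pmf (W x) y' = pmf (W (\<pi> x)) y))))"

definition joint_pmf :: "('x \<Rightarrow> 'y pmf) \<Rightarrow> 'x pmf \<Rightarrow> ('x \<times> 'y) pmf" where
  "joint_pmf W p = bind_pmf p (\<lambda>x. map_pmf (Pair x) (W x))"

text \<open>Base \<open>exp 1\<close>: all logarithms are natural.\<close>

definition mutual_info :: "('x::finite \<Rightarrow> 'y::finite pmf) \<Rightarrow> 'x pmf \<Rightarrow> real" where
  "mutual_info W p =
     prob_space.mutual_information (measure_pmf (joint_pmf W p)) (exp 1)
       (count_space UNIV) (count_space UNIV) fst snd"

definition E0 :: "('x::finite \<Rightarrow> 'y::finite pmf) \<Rightarrow> 'x pmf \<Rightarrow> real \<Rightarrow> real" where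
  "E0 W p \<rho> =
     - ln (\<Sum>y\<in>UNIV. (\<Sum>x\<in>UNIV. pmf p x * pmf (W x) y powr (1 / (1 + \<rho>))) powr (1 + \<rho>))"

text \<open>
  The exponents live in \<open>ereal\<close> because the outer code rate \<open>r\<close> may be \<open>0\<close>: there
  \<open>\<gamma> / r = \<infinity>\<close> for \<open>\<gamma> > 0\<close>, whereas real division would give \<open>0\<close> and inflate the maximum.
  As \<open>0 * \<infinity> = 0\<close> in \<open>ereal\<close>, the penalty term vanishes at \<open>\<rho> = 0\<close>, and also at \<open>\<gamma> = r = 0\<close>.
  The suprema below are the maxima of the paper: for positive mutual information they are attained.
\<close>

definition E_Fc_rate ::
    "('x::finite \<Rightarrow> 'y::finite pmf) \<Rightarrow> 'x pmf \<Rightarrow> real \<Rightarrow> real \<Rightarrow> ereal" where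
  "E_Fc_rate W p \<gamma> r =
     (SUP \<rho>\<in>{0..1}.
        ereal ((1 - r) * mutual_info W p) *
        (- (ereal \<rho> * (ereal \<gamma> / ereal r)) +
         ereal (E0 W p \<rho> / mutual_info W p * (1 - (1 + r) / 2 * E0 W p \<rho>))))"

definition E_Fc :: "('x::finite \<Rightarrow> 'y::finite pmf) \<Rightarrow> 'x pmf \<Rightarrow> real \<Rightarrow> ereal" where
  "E_Fc W p \<gamma> = (SUP r\<in>{0..1}. E_Fc_rate W p \<gamma> r)"

definition E_Fcs :: "('x::finite \<Rightarrow> 'y::finite pmf) \<Rightarrow> 'x pmf \<Rightarrow> real \<Rightarrow> ereal" where
  "E_Fcs W p \<gamma> = E_Fc_rate W p \<gamma> ((sqrt (\<gamma>\<^sup>2 + 8 * \<gamma>) - \<gamma>) / 2)"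

end

theory Submission
  imports Defs
begin

text \<open>
  Near \<open>\<gamma> = 1\<close> only outer code rates close to \<open>1\<close> and parameters \<open>\<rho>\<close> close to \<open>0\<close> matter. There
  \<open>E\<^sub>0(\<rho>) = I \<rho> - L \<rho>\<^sup>2 + o(\<rho>\<^sup>2)\<close>, so the bracket is \<open>\<rho> (1 - \<gamma>/r) - K \<rho>\<^sup>2\<close> up to lower-order terms,
  with \<open>K = L/I + I > 0\<close>. Maximizing over \<open>\<rho>\<close> gives
  \<open>E\<^sub>F\<^sub>c(\<gamma>, r) \<approx> I (1 - r) (1 - \<gamma>/r)\<^sup>2 / (4 K)\<close>, uniformly in \<open>r \<in> [\<gamma>, 1]\<close>, while
  \<open>E\<^sub>F\<^sub>c(\<gamma>, r) = 0\<close> for \<open>r \<le> \<gamma>\<close>. The rate \<open>(sqrt (\<gamma>\<^sup>2 + 8 \<gamma>) - \<gamma>) / 2\<close> maximizes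
  \<open>(1 - r) (1 - \<gamma>/r)\<^sup>2\<close> exactly, whatever the channel is.
\<close>

subsection \<open>Optimal rate of the quadratic approximation\<close>

text \<open>The last identity is the critical-point equation of
  \<open>(1 - r) * (1 - \<gamma> / r)\<^sup>2\<close> away from its double zero at
  \<open>r = \<gamma>\<close>, and \<open>s\<close> is its positive root. After squaring, both
  bounds on \<open>s\<close> come down to \<open>\<gamma> < 1\<close>.\<close>

lemma rate_properties:
  fixes \<gamma> :: real
  assumes "0 < \<gamma>" "\<gamma> < 1"
  defines "s \<equiv> (sqrt (\<gamma>\<^sup>2 + 8 * \<gamma>) - \<gamma>) / 2"
  shows "\<gamma> < s" "s < 1" "s\<^sup>2 = \<gamma> * (2 - s)"
proof -
  have sq: "sqrt (\<gamma>\<^sup>2 + 8 * \<gamma>) = 2 * s + \<gamma>"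
    by (simp add: s_def field_simps)
  have "(sqrt (\<gamma>\<^sup>2 + 8 * \<gamma>))\<^sup>2 = \<gamma>\<^sup>2 + 8 * \<gamma>"
    using assms by simp
  then have "(2 * s + \<gamma>)\<^sup>2 = \<gamma>\<^sup>2 + 8 * \<gamma>"
    by (simp only: sq)
  then show eq: "s\<^sup>2 = \<gamma> * (2 - s)"
    by (simp add: power2_eq_square algebra_simps)
  have "sqrt (\<gamma>\<^sup>2 + 8 * \<gamma>) < 2 + \<gamma>"
    using assms by (intro real_less_lsqrt) (auto simp: power2_eq_square algebra_simps)
  then show "s < 1"
    by (simp add: s_def)
  have "3 * \<gamma> < sqrt (\<gamma>\<^sup>2 + 8 * \<gamma>)"
    using assms by (intro real_less_rsqrt) (auto simp: power2_eq_square algebra_simps)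
  then show "\<gamma> < s"
    by (simp add: s_def)
qed

text \<open>As \<open>s\<close> is a critical point of the left-hand side in \<open>r\<close>, clearing denominators with
  \<open>\<gamma> = s\<^sup>2 / (2 - s)\<close> turns the claim into a cubic inequality in \<open>r\<close> with a double root at \<open>s\<close>.\<close>

lemma rate_optimal:
  fixes \<gamma> r :: real
  assumes \<gamma>: "0 < \<gamma>" "\<gamma> < 1" and r: "\<gamma> \<le> r" "r \<le> 1"
  defines "s \<equiv> (sqrt (\<gamma>\<^sup>2 + 8 * \<gamma>) - \<gamma>) / 2"
  shows "(1 - r) * (1 - \<gamma> / r)\<^sup>2 \<le> (1 - s) * (1 - \<gamma> / s)\<^sup>2"
proof -
  note s = rate_properties[OF \<gamma>, folded s_def]
  have "0 < s" using s \<gamma> by simp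
  have g: "\<gamma> = s\<^sup>2 / (2 - s)"
    using s(2,3) by simp
  \<comment> \<open>Prepares the nonnegativity of the linear factor that remains once
    \<open>(r - s)\<^sup>2\<close> is split off the cubic; \<open>2 - s\<close> is at least
    1.\<close>
  have "s\<^sup>2 \<le> (2 - s) * r"
    using s r by (simp add: mult.commute mult_right_mono)
  also have "\<dots> \<le> (2 - s)\<^sup>2 * r"
    using s \<gamma> r by (intro mult_right_mono) (auto simp: power2_eq_square)
  finally have "0 \<le> (r - s)\<^sup>2 * ((2 - s)\<^sup>2 * r - s\<^sup>2)"
    by simp
  also have "\<dots> = 4 * (1 - s) ^ 3 * r\<^sup>2 - (1 - r) * (r * (2 - s) - s\<^sup>2)\<^sup>2"
    by algebra
  finally have "(1 - r) * (r * (2 - s) - s\<^sup>2)\<^sup>2 \<le> 4 * (1 - s) ^ 3 * r\<^sup>2"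
    by simp
  then have "(1 - r) * (r * (2 - s) - s\<^sup>2)\<^sup>2 / (r * (2 - s))\<^sup>2
      \<le> 4 * (1 - s) ^ 3 * r\<^sup>2 / (r * (2 - s))\<^sup>2"
    by (intro divide_right_mono) auto
  moreover have "1 - \<gamma> / r = (r * (2 - s) - s\<^sup>2) / (r * (2 - s))"
    unfolding g using s(2) \<gamma> r by (simp add: diff_divide_distrib)
  moreover have "1 - \<gamma> / s = 2 * ((1 - s) / (2 - s))"
    unfolding g using s(2) \<open>0 < s\<close> by (simp add: field_simps power2_eq_square)
  moreover have "4 * (1 - s) ^ 3 * r\<^sup>2 / (r * (2 - s))\<^sup>2 = (1 - s) * (2 * ((1 - s) / (2 - s)))\<^sup>2"
    using \<gamma> r
    by (simp add: power_divide power_mult_distrib power3_eq_cube power2_eq_square[of "1 - s"],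
        simp add: power2_eq_square algebra_simps)
  ultimately show ?thesis
    by (simp add: power_divide)
qed

subsection \<open>Exponents of a function with a second-order expansion\<close>

text \<open>The objective of \<open>E_Fc_rate\<close> over the reals, with mutual information and
  Gallager's function turned into parameters. At \<open>r = 0\<close> real division would drop the
  penalty, so that rate is treated separately.\<close>

definition exponent_term :: "real \<Rightarrow> (real \<Rightarrow> real) \<Rightarrow> real \<Rightarrow> real \<Rightarrow> real \<Rightarrow> real" where
  "exponent_term I e \<gamma> r \<rho> =
     (1 - r) * I * (- (\<rho> * (\<gamma> / r)) + e \<rho> / I * (1 - (1 + r) / 2 * e \<rho>))"

text \<open>With \<open>x = \<gamma> / r\<close>, \<open>u = e \<rho>\<close> and
  \<open>c = (1 + r) / 2\<close> this isolates a coefficient of \<open>\<rho>\<^sup>2\<close> that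
  tends to \<open>L / I + c * I\<close> at 0, so the bracket can be compared with a
  parabola.\<close>

lemma bracket_expand:
  fixes I \<rho> c u x :: real
  assumes "I \<noteq> 0" "\<rho> \<noteq> 0"
  shows "- (\<rho> * x) + u / I * (1 - c * u)
    = \<rho> * (1 - x) - \<rho>\<^sup>2 * ((I * \<rho> - u) / \<rho>\<^sup>2 / I + c * ((u / \<rho>)\<^sup>2 / I))"
  using assms by (simp add: field_simps power2_eq_square)

lemma quadratic_le:
  fixes k x \<rho> :: real
  assumes "k > 0"
  shows "\<rho> * x - \<rho>\<^sup>2 * k \<le> x\<^sup>2 / (4 * k)"
proof -
  have "0 \<le> (x - 2 * k * \<rho>)\<^sup>2" by simp
  then have "(\<rho> * x - \<rho>\<^sup>2 * k) * (4 * k) \<le> x\<^sup>2"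
    by (simp add: power2_eq_square algebra_simps)
  then show ?thesis
    using assms by (simp add: pos_le_divide_eq)
qed

text \<open>Abstracts Gallager's function. The linear bound controls rates below \<gamma>, and
  monotonicity keeps \<open>e\<close> away from 0 for \<rho> bounded away from 0, so the expansion
  at 0 yields estimates uniform on [0, 1].\<close>

locale second_order_expansion =
  fixes I L :: real and e :: "real \<Rightarrow> real"
  assumes I_pos: "0 < I"
    and e_0: "e 0 = 0"
    and e_le: "\<And>\<rho>. 0 \<le> \<rho> \<Longrightarrow> e \<rho> \<le> I * \<rho>"
    and e_mono: "\<And>\<rho> \<rho>'. 0 \<le> \<rho> \<Longrightarrow> \<rho> \<le> \<rho>' \<Longrightarrow> e \<rho> \<le> e \<rho>'"
    and e_expansion: "((\<lambda>\<rho>. (I * \<rho> - e \<rho>) / \<rho>\<^sup>2) \<longlongrightarrow> L) (at_right 0)"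
begin

lemma e_nonneg: "0 \<le> \<rho> \<Longrightarrow> 0 \<le> e \<rho>"
  using e_mono[of 0 \<rho>] e_0 by simp

lemma tendsto_slope: "((\<lambda>\<rho>. e \<rho> / \<rho>) \<longlongrightarrow> I) (at_right 0)"
proof -
  have "((\<lambda>\<rho>. I - \<rho> * ((I * \<rho> - e \<rho>) / \<rho>\<^sup>2)) \<longlongrightarrow> I - 0 * L) (at_right 0)"
    by (intro tendsto_intros e_expansion)
  then have lim: "((\<lambda>\<rho>. I - \<rho> * ((I * \<rho> - e \<rho>) / \<rho>\<^sup>2)) \<longlongrightarrow> I) (at_right 0)"
    by simp
  have "\<forall>\<^sub>F \<rho> in at_right 0. I - \<rho> * ((I * \<rho> - e \<rho>) / \<rho>\<^sup>2) = e \<rho> / \<rho>"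
    using eventually_at_right_less[of "0::real"]
    by eventually_elim (simp add: field_simps power2_eq_square)
  from Lim_transform_eventually[OF lim this] show ?thesis .
qed

lemma L_nonneg: "0 \<le> L"
  using e_expansion
proof (rule tendsto_lowerbound)
  show "\<forall>\<^sub>F \<rho> in at_right 0. 0 \<le> (I * \<rho> - e \<rho>) / \<rho>\<^sup>2"
    using eventually_at_right_less[of "0::real"]
    by eventually_elim (simp add: e_le)
qed simp

lemma tendsto_quadratic_coefficient:
  "((\<lambda>\<rho>. (I * \<rho> - e \<rho>) / \<rho>\<^sup>2 / I + c * ((e \<rho> / \<rho>)\<^sup>2 / I)) \<longlongrightarrow> L / I + c * I) (at_right 0)"
proof -
  have "((\<lambda>\<rho>. (I * \<rho> - e \<rho>) / \<rho>\<^sup>2 / I + c * ((e \<rho> / \<rho>)\<^sup>2 / I)) \<longlongrightarrow> L / I + c * (I\<^sup>2 / I)) (at_right 0)"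
    using I_pos by (intro tendsto_intros e_expansion tendsto_slope) auto
  then show ?thesis
    using I_pos by (simp add: power2_eq_square)
qed

text \<open>At rates up to \<gamma> the linear penalty is at least \<rho>, while
  \<open>e \<rho> / I\<close> is at most \<rho> and the quadratic correction only lowers it.\<close>

lemma exponent_term_nonpos:
  assumes "0 < r" "r \<le> \<gamma>" "r \<le> 1" "0 \<le> \<rho>"
  shows "exponent_term I e \<gamma> r \<rho> \<le> 0"
proof -
  have "e \<rho> / I * (1 - (1 + r) / 2 * e \<rho>) \<le> e \<rho> / I * 1"
    using assms I_pos e_nonneg[of \<rho>] by (intro mult_left_mono) auto
  also have "\<dots> \<le> \<rho>"
    using e_le[of \<rho>] assms I_pos by (simp add: field_simps)
  also have "\<rho> * 1 \<le> \<rho> * (\<gamma> / r)"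
    using assms by (intro mult_left_mono) auto
  finally show ?thesis
    using assms I_pos unfolding exponent_term_def
    by (intro mult_nonneg_nonpos) auto
qed

text \<open>Small \<rho> is handled by comparison with a parabola of coefficient \<open>k\<close>.
  For \<rho> bounded away from 0 the loss \<open>(1 + r) / 2 * e \<rho>\<close> has a fixed positive
  lower bound, which exceeds \<open>1 - \<gamma>\<close> for \<gamma> near 1 and makes the bracket
  nonpositive.\<close>

lemma exponent_term_upper:
  assumes k: "0 < k" "k < L / I + I"
  shows "\<forall>\<^sub>F \<gamma> in at_left 1. \<forall>r\<in>{\<gamma>..1}. \<forall>\<rho>\<in>{0..1}.
    exponent_term I e \<gamma> r \<rho> \<le> (1 - r) * (1 - \<gamma> / r)\<^sup>2 * (I / (4 * k))"
proof -
  \<comment> \<open>Replacing the factor \<open>(1 + r) / 2\<close> by \<open>1 - \<eta>\<close>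
    uses up half of the gap between \<open>k\<close> and \<open>L / I + I\<close>.\<close>
  define \<eta> where "\<eta> = (L / I + I - k) / (2 * I)"
  have \<eta>: "0 < \<eta>" using k I_pos by (simp add: \<eta>_def)
  have "\<eta> * I = (L / I + I - k) / 2"
    using I_pos by (simp add: \<eta>_def)
  then have lim: "k < L / I + (1 - \<eta>) * I"
    using k by (simp add: algebra_simps)
  have "\<forall>\<^sub>F \<rho> in at_right 0. k < (I * \<rho> - e \<rho>) / \<rho>\<^sup>2 / I + (1 - \<eta>) * ((e \<rho> / \<rho>)\<^sup>2 / I)"
    using order_tendstoD(1)[OF tendsto_quadratic_coefficient lim] .
  moreover have "\<forall>\<^sub>F \<rho> in at_right 0. 0 < e \<rho> / \<rho>"
    using order_tendstoD(1)[OF tendsto_slope I_pos] .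
  ultimately have "\<forall>\<^sub>F \<rho> in at_right 0.
      k < (I * \<rho> - e \<rho>) / \<rho>\<^sup>2 / I + (1 - \<eta>) * ((e \<rho> / \<rho>)\<^sup>2 / I) \<and> 0 < e \<rho> / \<rho>"
    by eventually_elim simp
  then obtain b where b: "0 < b" and small:
    "\<And>\<rho>. 0 < \<rho> \<Longrightarrow> \<rho> < b \<Longrightarrow>
      k < (I * \<rho> - e \<rho>) / \<rho>\<^sup>2 / I + (1 - \<eta>) * ((e \<rho> / \<rho>)\<^sup>2 / I) \<and> 0 < e \<rho> / \<rho>"
    unfolding eventually_at_right_field by blast
  \<comment> \<open>By monotonicity \<open>d\<close> bounds \<open>e\<close> from below from
    \<open>b / 2\<close> onwards; it is positive because the slope \<open>e \<rho> / \<rho>\<close>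
    is positive on (0, b).\<close>
  define d where "d = e (b / 2)"
  have d: "0 < d"
    using small[of "b / 2"] b by (simp add: d_def zero_less_divide_iff)
  \<comment> \<open>For r between \<gamma> and 1 the threshold \<open>1 - \<eta>\<close> gives
    \<open>1 - \<eta> \<le> (1 + r) / 2\<close>, and the threshold \<open>1 - d / 2\<close> pushes
    \<open>1 - (1 + r) / 2 * e \<rho>\<close> below \<gamma> once
    \<open>d \<le> e \<rho>\<close>.\<close>
  have "\<forall>\<^sub>F \<gamma> in at_left (1::real). \<gamma> \<in> {max 0 (max (1 - \<eta>) (1 - d / 2))<..<1}"
    using \<eta> d by (intro eventually_at_left_real) auto
  then show ?thesis
  proof eventually_elim
    case (elim \<gamma>)
    show ?case
    proof (intro ballI)
      fix r \<rho> :: real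
      assume r: "r \<in> {\<gamma>..1}" and \<rho>: "\<rho> \<in> {0..1}"
      have r0: "0 < r" using elim r by auto
      have "- (\<rho> * (\<gamma> / r)) + e \<rho> / I * (1 - (1 + r) / 2 * e \<rho>) \<le> (1 - \<gamma> / r)\<^sup>2 / (4 * k)"
      proof (cases "\<rho> = 0 \<or> b / 2 \<le> \<rho>")
        case True
        have "e \<rho> / I * (1 - (1 + r) / 2 * e \<rho>) \<le> \<rho> * (\<gamma> / r)"
        proof (cases "\<rho> = 0")
          case True
          then show ?thesis by (simp add: e_0)
        next
          case False
          with True have "d \<le> e \<rho>"
            using b by (auto simp: d_def intro!: e_mono)
          then have "1 / 2 * d \<le> (1 + r) / 2 * e \<rho>"
            using d r0 by (intro mult_mono) auto
          then have "e \<rho> / I * (1 - (1 + r) / 2 * e \<rho>) \<le> e \<rho> / I * \<gamma>"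
            using elim \<rho> I_pos e_nonneg[of \<rho>] by (intro mult_left_mono) auto
          also have "\<dots> \<le> \<rho> * \<gamma>"
            using e_le[of \<rho>] \<rho> I_pos elim by (intro mult_right_mono) (auto simp: field_simps)
          also have "\<dots> \<le> \<rho> * (\<gamma> / r)"
            using \<rho> r r0 elim by (intro mult_left_mono) (auto simp: field_simps)
          finally show ?thesis .
        qed
        then have "- (\<rho> * (\<gamma> / r)) + e \<rho> / I * (1 - (1 + r) / 2 * e \<rho>) \<le> 0"
          by simp
        also have "0 \<le> (1 - \<gamma> / r)\<^sup>2 / (4 * k)"
          using k by simp
        finally show ?thesis .
      next
        case False
        then have \<rho>': "0 < \<rho>" "\<rho> < b" using \<rho> by auto
        have "k \<le> (I * \<rho> - e \<rho>) / \<rho>\<^sup>2 / I + (1 - \<eta>) * ((e \<rho> / \<rho>)\<^sup>2 / I)"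
          using small[OF \<rho>'] by simp
        also have "\<dots> \<le> (I * \<rho> - e \<rho>) / \<rho>\<^sup>2 / I + (1 + r) / 2 * ((e \<rho> / \<rho>)\<^sup>2 / I)"
          using r elim I_pos by (intro add_left_mono mult_right_mono) auto
        finally have "\<rho> * (1 - \<gamma> / r) - \<rho>\<^sup>2 *
            ((I * \<rho> - e \<rho>) / \<rho>\<^sup>2 / I + (1 + r) / 2 * ((e \<rho> / \<rho>)\<^sup>2 / I))
            \<le> \<rho> * (1 - \<gamma> / r) - \<rho>\<^sup>2 * k"
          by (intro diff_left_mono mult_left_mono) auto
        also have "\<dots> \<le> (1 - \<gamma> / r)\<^sup>2 / (4 * k)"
          using quadratic_le[OF k(1)] .
        finally show ?thesis
          using \<rho>' I_pos by (subst bracket_expand) auto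
      qed
      then have "exponent_term I e \<gamma> r \<rho> \<le> (1 - r) * I * ((1 - \<gamma> / r)\<^sup>2 / (4 * k))"
        unfolding exponent_term_def using r I_pos by (intro mult_left_mono) auto
      then show "exponent_term I e \<gamma> r \<rho> \<le> (1 - r) * (1 - \<gamma> / r)\<^sup>2 * (I / (4 * k))"
        by (simp add: mult_ac)
    qed
  qed
qed

lemma exponent_term_lower:
  assumes k: "L / I + I < k"
  shows "\<forall>\<^sub>F \<gamma> in at_left 1. \<forall>r\<in>{\<gamma><..1}. \<exists>\<rho>\<in>{0..1}.
    (1 - r) * (1 - \<gamma> / r)\<^sup>2 * (I / (4 * k)) \<le> exponent_term I e \<gamma> r \<rho>"
proof -
  have k0: "0 < k"
    using L_nonneg I_pos k by (smt (verit) divide_nonneg_pos)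
  \<comment> \<open>The factor 1 bounds \<open>(1 + r) / 2\<close> for all rates up to 1 at
    once.\<close>
  have "L / I + 1 * I < k" using k by simp
  then have "\<forall>\<^sub>F \<rho> in at_right 0. (I * \<rho> - e \<rho>) / \<rho>\<^sup>2 / I + 1 * ((e \<rho> / \<rho>)\<^sup>2 / I) < k"
    using order_tendstoD(2)[OF tendsto_quadratic_coefficient] by blast
  then obtain b where b: "0 < b" and small:
    "\<And>\<rho>. 0 < \<rho> \<Longrightarrow> \<rho> < b \<Longrightarrow> (I * \<rho> - e \<rho>) / \<rho>\<^sup>2 / I + 1 * ((e \<rho> / \<rho>)\<^sup>2 / I) < k"
    unfolding eventually_at_right_field by blast
  have "\<forall>\<^sub>F \<gamma> in at_left (1::real). \<gamma> \<in> {max 0 (max (1 - k * b) (1 - k))<..<1}"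
    using k0 b by (intro eventually_at_left_real) auto
  then show ?thesis
  proof eventually_elim
    case (elim \<gamma>)
    show ?case
    proof (intro ballI)
      fix r :: real assume r: "r \<in> {\<gamma><..1}"
      have r0: "0 < r" using elim r by auto
      define x where "x = 1 - \<gamma> / r"
      \<comment> \<open>The vertex of the parabola \<open>\<rho> * x - \<rho>\<^sup>2 * k\<close>,
        where \<open>quadratic_le\<close> is an equality. As \<open>x \<le> 1 - \<gamma>\<close>,
        the thresholds on \<gamma> put it below both \<open>b\<close> and 1.\<close>
      define \<rho> where "\<rho> = x / (2 * k)"
      have x: "0 < x" "x \<le> 1 - \<gamma>"
        using r r0 elim by (auto simp: x_def field_simps)
      have \<rho>: "0 < \<rho>" "\<rho> < b" "\<rho> \<le> 1"
        using x elim k0 by (auto simp: \<rho>_def field_simps)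
      have "(I * \<rho> - e \<rho>) / \<rho>\<^sup>2 / I + (1 + r) / 2 * ((e \<rho> / \<rho>)\<^sup>2 / I)
          \<le> (I * \<rho> - e \<rho>) / \<rho>\<^sup>2 / I + 1 * ((e \<rho> / \<rho>)\<^sup>2 / I)"
        using r I_pos by (intro add_left_mono mult_right_mono) auto
      also have "\<dots> \<le> k"
        using small[OF \<rho>(1,2)] by simp
      finally have "\<rho> * x - \<rho>\<^sup>2 * k \<le> \<rho> * x - \<rho>\<^sup>2 *
            ((I * \<rho> - e \<rho>) / \<rho>\<^sup>2 / I + (1 + r) / 2 * ((e \<rho> / \<rho>)\<^sup>2 / I))"
        by (intro diff_left_mono mult_left_mono) auto
      also have "\<dots> = - (\<rho> * (\<gamma> / r)) + e \<rho> / I * (1 - (1 + r) / 2 * e \<rho>)"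
        unfolding x_def using \<rho> I_pos by (subst bracket_expand) auto
      also have "\<rho> * x - \<rho>\<^sup>2 * k = x\<^sup>2 / (4 * k)"
        using k0 by (simp add: \<rho>_def field_simps power2_eq_square)
      finally have "(1 - r) * I * (x\<^sup>2 / (4 * k)) \<le> exponent_term I e \<gamma> r \<rho>"
        unfolding exponent_term_def using r I_pos by (intro mult_left_mono) auto
      then show "\<exists>\<rho>\<in>{0..1}. (1 - r) * (1 - \<gamma> / r)\<^sup>2 * (I / (4 * k)) \<le> exponent_term I e \<gamma> r \<rho>"
        using \<rho> by (intro bexI[of _ \<rho>]) (auto simp: x_def mult_ac)
    qed
  qed
qed

end

text \<open>One application of L'Hopital's rule leaves half the negated difference quotient of
  \<open>f'\<close> at 0, so \<open>f'\<close> has to be differentiable only at that point.\<close>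

lemma second_order_limit:
  fixes f f' :: "real \<Rightarrow> real"
  assumes f0: "f 0 = 0"
    and f': "\<And>x. 0 \<le> x \<Longrightarrow> (f has_real_derivative f' x) (at x)"
    and f'': "(f' has_real_derivative D) (at 0)"
  shows "((\<lambda>x. (f' 0 * x - f x) / x\<^sup>2) \<longlongrightarrow> - D / 2) (at_right 0)"
proof (rule lhopital_right_0[where f' = "\<lambda>x. f' 0 - f' x" and g' = "\<lambda>x. 2 * x"])
  have "isCont f 0"
    using f'[of 0] DERIV_isCont by blast
  then have "(f \<longlongrightarrow> 0) (at_right 0)"
    using f0 by (simp add: isCont_def filterlim_at_split)
  then have "((\<lambda>x. f' 0 * x - f x) \<longlongrightarrow> f' 0 * 0 - 0) (at_right 0)"
    by (intro tendsto_intros)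
  then show "((\<lambda>x. f' 0 * x - f x) \<longlongrightarrow> 0) (at_right 0)" by simp
  have "((\<lambda>x::real. x\<^sup>2) \<longlongrightarrow> 0\<^sup>2) (at_right 0)" by (intro tendsto_intros)
  then show "((\<lambda>x::real. x\<^sup>2) \<longlongrightarrow> 0) (at_right 0)" by simp
  show "\<forall>\<^sub>F x in at_right 0. ((\<lambda>x. f' 0 * x - f x) has_real_derivative f' 0 - f' x) (at x)"
    using eventually_at_right_less[of "0::real"]
  proof eventually_elim
    case (elim x)
    show ?case
      using DERIV_diff[OF DERIV_cmult_Id[of "f' 0" x UNIV] f'[of x]] elim by simp
  qed
  show "\<forall>\<^sub>F x in at_right 0. (power2 has_real_derivative 2 * x) (at (x::real))"
    by (auto intro!: derivative_eq_intros always_eventually)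
  have "((\<lambda>x. (f' x - f' 0) / x) \<longlongrightarrow> D) (at_right 0)"
    using f'' by (simp add: has_field_derivative_iff filterlim_at_split)
  then have "((\<lambda>x. - ((f' x - f' 0) / x) / 2) \<longlongrightarrow> - D / 2) (at_right 0)"
    by (intro tendsto_intros) auto
  moreover have "(\<lambda>x. - ((f' x - f' 0) / x) / 2) = (\<lambda>x. (f' 0 - f' x) / (2 * x))"
  proof
    fix x
    show "- ((f' x - f' 0) / x) / 2 = (f' 0 - f' x) / (2 * x)"
      by (cases "x = 0") (simp_all add: field_simps)
  qed
  ultimately show "((\<lambda>x. (f' 0 - f' x) / (2 * x)) \<longlongrightarrow> - D / 2) (at_right 0)"
    by simp
next
  show "\<forall>\<^sub>F x in at_right 0. x\<^sup>2 \<noteq> (0::real)" "\<forall>\<^sub>F x in at_right 0. 2 * x \<noteq> (0::real)"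
    using eventually_at_right_less[of "0::real"] by (eventually_elim; simp)+
qed

subsection \<open>Gallager's function\<close>

text \<open>Jensen's inequality for exp with unnormalised weights: the tangent-line bounds at the
  weighted mean \<open>c\<close> are summed, and their linear parts cancel.\<close>

lemma exp_weighted_mean_le:
  fixes w u :: "'a \<Rightarrow> real"
  assumes "finite A" "\<And>i. i \<in> A \<Longrightarrow> 0 \<le> w i" "0 < sum w A"
  shows "sum w A * exp ((\<Sum>i\<in>A. w i * u i) / sum w A) \<le> (\<Sum>i\<in>A. w i * exp (u i))"
proof -
  define c where "c = (\<Sum>i\<in>A. w i * u i) / sum w A"
  have c: "(\<Sum>i\<in>A. w i * u i) = c * sum w A"
    using assms by (simp add: c_def)
  have "sum w A * exp c = (\<Sum>i\<in>A. w i * (exp c * (1 + (u i - c))))"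
  proof -
    have "(\<Sum>i\<in>A. w i * (exp c * (1 + (u i - c))))
        = (\<Sum>i\<in>A. exp c * w i * (1 - c) + exp c * (w i * u i))"
      by (intro sum.cong) (auto simp: algebra_simps)
    also have "\<dots> = exp c * (1 - c) * sum w A + exp c * (\<Sum>i\<in>A. w i * u i)"
      by (simp add: sum.distrib sum_distrib_left sum_distrib_right mult_ac)
    also have "\<dots> = sum w A * exp c"
      unfolding c by (simp add: algebra_simps)
    finally show ?thesis by simp
  qed
  also have "\<dots> \<le> (\<Sum>i\<in>A. w i * exp (u i))"
  proof (intro sum_mono mult_left_mono)
    fix i
    have "exp c * (1 + (u i - c)) \<le> exp c * exp (u i - c)"
      by (intro mult_left_mono exp_ge_add_one_self) auto
    then show "exp c * (1 + (u i - c)) \<le> exp (u i)"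
      by (simp flip: exp_add)
  qed (use assms in auto)
  finally show ?thesis by (simp add: c_def)
qed

section \<open>Output probabilities and tilted sums\<close>

context
  fixes W :: "'x::finite \<Rightarrow> 'y::finite pmf" and p :: "'x pmf"
begin

definition output_prob :: "'y \<Rightarrow> real" where
  "output_prob y = (\<Sum>x\<in>UNIV. pmf p x * pmf (W x) y)"

definition tilted :: "real \<Rightarrow> 'y \<Rightarrow> real" where
  "tilted \<rho> y = (\<Sum>x\<in>UNIV. pmf p x * pmf (W x) y powr (1 / (1 + \<rho>)))"

lemma output_prob_nonneg: "0 \<le> output_prob y"
  unfolding output_prob_def by (intro sum_nonneg) auto

lemma tilted_nonneg: "0 \<le> tilted \<rho> y"
  unfolding tilted_def by (intro sum_nonneg) auto

lemma tilted_0: "tilted 0 y = output_prob y"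
  by (simp add: tilted_def output_prob_def)

text \<open>As \<open>0 powr a = 0\<close> for every exponent and positive bases have positive
  powers, both sides say that no input of positive probability leads to \<open>y\<close>. The
  summand of such an output vanishes for all \<rho> and can be split off.\<close>

lemma tilted_eq_0_iff: "tilted \<rho> y = 0 \<longleftrightarrow> output_prob y = 0"
  unfolding tilted_def output_prob_def
  by (subst (1 2) sum_nonneg_eq_0_iff) auto

lemma sum_output_prob: "(\<Sum>y\<in>UNIV. output_prob y) = 1"
  unfolding output_prob_def
  by (subst sum.swap) (simp add: sum_pmf_eq_1 flip: sum_distrib_left)

section \<open>Mutual information as a finite sum\<close>

lemma pmf_joint: "pmf (joint_pmf W p) (x, y) = pmf p x * pmf (W x) y"
proof -
  have *: "pmf (map_pmf (Pair x') (W x')) (x, y) = (if x' = x then pmf (W x) y else 0)" for x'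
  proof (cases "x' = x")
    case True
    then show ?thesis by (simp add: pmf_map_inj' inj_on_def)
  next
    case False
    then show ?thesis by (auto intro!: pmf_map_outside)
  qed
  have "pmf (joint_pmf W p) (x, y)
      = (\<Sum>x'\<in>UNIV. pmf (map_pmf (Pair x') (W x')) (x, y) * pmf p x')"
    unfolding joint_pmf_def pmf_bind by (rule integral_measure_pmf_real) auto
  also have "\<dots> = (\<Sum>x'\<in>UNIV. if x' = x then pmf p x' * pmf (W x) y else 0)"
    unfolding * by (intro sum.cong) auto
  finally show ?thesis by simp
qed

lemma mutual_info_eq:
  "mutual_info W p =
    (\<Sum>y\<in>UNIV. \<Sum>x\<in>UNIV. pmf p x * pmf (W x) y * ln (pmf (W x) y / output_prob y))"
proof -
  let ?J = "joint_pmf W p"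
  interpret information_space "measure_pmf ?J" "exp 1"
    by unfold_locales simp
  have meas: "measure_pmf.prob ?J A = (\<Sum>z\<in>A. pmf p (fst z) * pmf (W (fst z)) (snd z))" for A
    by (subst measure_measure_pmf_finite) (auto intro!: sum.cong simp: pmf_joint[symmetric])
  have X: "simple_distributed (measure_pmf ?J) fst (pmf p)"
  proof (rule measure_pmf.simple_distributedI)
    fix x :: 'x
    have "fst -` {x} = Pair x ` (UNIV :: 'y set)" by auto
    then show "pmf p x = measure_pmf.prob ?J (fst -` {x} \<inter> space (measure_pmf ?J))"
      by (simp add: meas sum.reindex inj_on_def sum_pmf_eq_1 flip: sum_distrib_left)
  qed (auto simp: simple_function_def)
  have Y: "simple_distributed (measure_pmf ?J) snd output_prob"
  proof (rule measure_pmf.simple_distributedI)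
    fix y :: 'y
    have "snd -` {y} = (\<lambda>x. (x, y)) ` (UNIV :: 'x set)" by auto
    then show "output_prob y = measure_pmf.prob ?J (snd -` {y} \<inter> space (measure_pmf ?J))"
      by (simp add: meas sum.reindex inj_on_def output_prob_def)
  qed (auto simp: simple_function_def output_prob_nonneg)
  have XY: "simple_distributed (measure_pmf ?J) (\<lambda>z. (fst z, snd z)) (\<lambda>z. pmf p (fst z) * pmf (W (fst z)) (snd z))"
    by (rule measure_pmf.simple_distributedI) (auto simp: simple_function_def meas vimage_def)
  have "mutual_info W p = (\<Sum>(x, y)\<in>UNIV. pmf p x * pmf (W x) y *
      log (exp 1) (pmf p x * pmf (W x) y / (pmf p x * output_prob y)))"
    unfolding mutual_info_def
    using mutual_information_simple_distributed[OF X Y XY] by simp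
  also have "\<dots> = (\<Sum>x\<in>UNIV. \<Sum>y\<in>UNIV. pmf p x * pmf (W x) y *
      log (exp 1) (pmf p x * pmf (W x) y / (pmf p x * output_prob y)))"
    by (simp add: sum.cartesian_product)
  \<comment> \<open>The factor \<open>pmf p x\<close> cancels inside the logarithm unless it is 0,
    and then the weight vanishes.\<close>
  also have "\<dots> = (\<Sum>x\<in>UNIV. \<Sum>y\<in>UNIV. pmf p x * pmf (W x) y * ln (pmf (W x) y / output_prob y))"
    by (intro sum.cong) (auto simp: log_def)
  also have "\<dots> = (\<Sum>y\<in>UNIV. \<Sum>x\<in>UNIV. pmf p x * pmf (W x) y * ln (pmf (W x) y / output_prob y))"
    by (rule sum.swap)
  finally show ?thesis .
qed

section \<open>Exponential lower bound on the tilted sum\<close>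

definition divergence :: "'y \<Rightarrow> real" where
  "divergence y = (\<Sum>x\<in>UNIV. pmf p x * pmf (W x) y * ln (pmf (W x) y / output_prob y)) / output_prob y"

lemma output_prob_times_divergence:
  "output_prob y * divergence y =
    (\<Sum>x\<in>UNIV. pmf p x * pmf (W x) y * ln (pmf (W x) y / output_prob y))"
  by (simp add: divergence_def)

text \<open>For an output of positive probability, \<open>divergence y\<close> is the relative
  entropy of the posterior input law given \<open>y\<close> from \<open>p\<close>. The bound is
  Jensen's inequality under that posterior, raised to the power \<open>1 + \<rho>\<close>.\<close>

lemma tilted_powr_ge:
  assumes "-1 < \<rho>"
  shows "output_prob y * exp (- \<rho> * divergence y) \<le> tilted \<rho> y powr (1 + \<rho>)"
proof (cases "output_prob y = 0")
  case True
  then show ?thesis by simp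
next
  case False
  then have q: "0 < output_prob y" using output_prob_nonneg[of y] by simp
  define w where "w x = pmf p x * pmf (W x) y" for x
  \<comment> \<open>Chosen so that \<open>1 / (1 + \<rho>) = 1 - s\<close>, which turns the tilt
    into an exponential factor on the weights \<open>w\<close>;
    \<open>(1 + \<rho>) * s = \<rho>\<close> then restores the exponent of the claim.\<close>
  define s where "s = \<rho> / (1 + \<rho>)"
  have sw: "sum w UNIV = output_prob y"
    by (simp add: w_def output_prob_def)
  have w_pos: "0 < pmf (W x) y" if "w x \<noteq> 0" for x
    using that by (simp add: w_def order_less_le)
  define u where "u x = - s * ln (pmf (W x) y / output_prob y)" for x
  have "(\<Sum>x\<in>UNIV. w x * u x) = - s * (\<Sum>x\<in>UNIV. w x * ln (pmf (W x) y / output_prob y))"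
    by (simp add: u_def sum_distrib_left mult_ac)
  then have mean: "(\<Sum>x\<in>UNIV. w x * u x) / sum w UNIV = - s * divergence y"
    unfolding sw by (simp add: divergence_def w_def)
  have "w x * exp (u x) = output_prob y powr s * (pmf p x * pmf (W x) y powr (1 / (1 + \<rho>)))" for x
  proof (cases "w x = 0")
    case False
    note W0 = w_pos[OF False]
    have s: "1 / (1 + \<rho>) = 1 - s"
      using assms by (simp add: s_def field_simps)
    have "pmf (W x) y powr (1 / (1 + \<rho>)) = pmf (W x) y * exp (- s * ln (pmf (W x) y))"
      unfolding s using W0 by (simp add: powr_diff powr_def[of _ s] exp_minus field_simps)
    moreover have "exp (u x) = exp (s * ln (output_prob y)) * exp (- s * ln (pmf (W x) y))"
      using W0 q by (simp add: u_def ln_div algebra_simps flip: exp_add)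
    ultimately show ?thesis
      using q by (simp add: w_def powr_def)
  qed (auto simp: w_def)
  then have "(\<Sum>x\<in>UNIV. w x * exp (u x)) = output_prob y powr s * tilted \<rho> y"
    by (simp add: tilted_def sum_distrib_left)
  then have "output_prob y * exp (- s * divergence y) \<le> output_prob y powr s * tilted \<rho> y"
    using exp_weighted_mean_le[of UNIV w u] mean q sw by (simp add: w_def)
  then have "(output_prob y * exp (- s * divergence y)) powr (1 + \<rho>)
      \<le> (output_prob y powr s * tilted \<rho> y) powr (1 + \<rho>)"
    using assms q by (intro powr_mono2) auto
  also have "(output_prob y powr s * tilted \<rho> y) powr (1 + \<rho>)
      = output_prob y powr \<rho> * tilted \<rho> y powr (1 + \<rho>)"
    using assms tilted_nonneg by (simp add: powr_mult powr_powr s_def)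
  also have "(output_prob y * exp (- s * divergence y)) powr (1 + \<rho>)
      = output_prob y powr \<rho> * (output_prob y * exp (- \<rho> * divergence y))"
  proof -
    have "(1 + \<rho>) * s = \<rho>" using assms by (simp add: s_def)
    then have "(1 + \<rho>) * (s * divergence y) = \<rho> * divergence y"
      by (metis mult.assoc)
    then have "exp (- s * divergence y) powr (1 + \<rho>) = exp (- \<rho> * divergence y)"
      by (simp add: powr_def)
    moreover have "output_prob y powr (1 + \<rho>) = output_prob y powr \<rho> * output_prob y"
      using q by (simp add: powr_add)
    ultimately show ?thesis
      using q by (simp add: powr_mult)
  qed
  finally show ?thesis
    using q by simp
qed

text \<open>A second use of Jensen's inequality, now over the outputs: the mean of
  \<open>divergence\<close> under \<open>output_prob\<close> is the mutual information.\<close>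

lemma sum_tilted_ge:
  assumes "-1 < \<rho>"
  shows "exp (- \<rho> * mutual_info W p) \<le> (\<Sum>y\<in>UNIV. tilted \<rho> y powr (1 + \<rho>))"
proof -
  have "(\<Sum>y\<in>UNIV. output_prob y * (- \<rho> * divergence y))
      = - \<rho> * (\<Sum>y\<in>UNIV. output_prob y * divergence y)"
    by (simp add: sum_distrib_left mult_ac)
  also have "\<dots> = - \<rho> * mutual_info W p"
    by (simp only: output_prob_times_divergence mutual_info_eq)
  finally have "exp (- \<rho> * mutual_info W p) \<le> (\<Sum>y\<in>UNIV. output_prob y * exp (- \<rho> * divergence y))"
    using exp_weighted_mean_le[of UNIV output_prob "\<lambda>y. - \<rho> * divergence y"]
    by (simp add: sum_output_prob output_prob_nonneg)
  also have "\<dots> \<le> (\<Sum>y\<in>UNIV. tilted \<rho> y powr (1 + \<rho>))"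
    by (intro sum_mono tilted_powr_ge assms)
  finally show ?thesis .
qed

lemma sum_tilted_pos: "-1 < \<rho> \<Longrightarrow> 0 < (\<Sum>y\<in>UNIV. tilted \<rho> y powr (1 + \<rho>))"
  using sum_tilted_ge[of \<rho>] by (rule less_le_trans[OF exp_gt_zero])

section \<open>Linear bound and monotonicity of Gallager's function\<close>

lemma E0_eq: "E0 W p \<rho> = - ln (\<Sum>y\<in>UNIV. tilted \<rho> y powr (1 + \<rho>))"
  by (simp add: E0_def tilted_def)

lemma E0_le: "-1 < \<rho> \<Longrightarrow> E0 W p \<rho> \<le> mutual_info W p * \<rho>"
  using sum_tilted_ge[of \<rho>] sum_tilted_pos[of \<rho>]
  by (simp add: E0_eq ln_ge_iff mult.commute[of "mutual_info W p"] minus_le_iff)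

lemma E0_0: "E0 W p 0 = 0"
  by (simp add: E0_eq tilted_0 sum_output_prob output_prob_nonneg)

text \<open>With \<open>t = 1 / (1 + \<rho>)\<close> this is the power mean of order t of
  \<open>pmf (W x) y\<close> under \<open>p\<close>, which increases with t. Dividing by
  \<open>N\<close> normalises the mean to 1 and leaves Young's inequality
  \<open>a powr \<alpha> \<le> \<alpha> * a + (1 - \<alpha>)\<close>.\<close>

lemma tilted_powr_antimono:
  assumes "0 \<le> \<rho>" "\<rho> \<le> \<rho>'"
  shows "tilted \<rho>' y powr (1 + \<rho>') \<le> tilted \<rho> y powr (1 + \<rho>)"
proof (cases "output_prob y = 0")
  case True
  then have "tilted \<rho>' y = 0" "tilted \<rho> y = 0" by (simp_all add: tilted_eq_0_iff)
  then show ?thesis by simp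
next
  case False
  define \<alpha> where "\<alpha> = (1 + \<rho>) / (1 + \<rho>')"
  define N where "N = tilted \<rho> y"
  have N: "0 < N"
    using False tilted_nonneg[of \<rho> y] tilted_eq_0_iff[of \<rho> y] by (simp add: N_def)
  have \<alpha>: "0 \<le> \<alpha>" "\<alpha> \<le> 1" using assms by (auto simp: \<alpha>_def)
  have "tilted \<rho>' y / N powr \<alpha>
      = (\<Sum>x\<in>UNIV. pmf p x * ((pmf (W x) y powr (1 / (1 + \<rho>)) / N) powr \<alpha> * 1 powr (1 - \<alpha>)))"
    unfolding tilted_def sum_divide_distrib
    using assms N by (intro sum.cong) (auto simp: powr_divide powr_powr \<alpha>_def)
  also have "\<dots> \<le> (\<Sum>x\<in>UNIV. pmf p x * (\<alpha> * (pmf (W x) y powr (1 / (1 + \<rho>)) / N) + (1 - \<alpha>) * 1))"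
  proof (intro sum_mono mult_left_mono)
    fix x
    let ?a = "pmf (W x) y powr (1 / (1 + \<rho>)) / N"
    show "?a powr \<alpha> * 1 powr (1 - \<alpha>) \<le> \<alpha> * ?a + (1 - \<alpha>) * 1"
    proof (cases "?a = 0")
      case True
      then show ?thesis using \<alpha> by (simp only:) simp
    next
      case False
      then have "0 < ?a" using N by (simp add: order_less_le)
      then show ?thesis using \<alpha> by (intro Youngs_inequality_0) auto
    qed
  qed auto
  also have "\<dots> = \<alpha> / N * tilted \<rho> y + (1 - \<alpha>) * (\<Sum>x\<in>UNIV. pmf p x)"
    unfolding tilted_def
    by (simp add: distrib_left sum.distrib sum_distrib_left mult_ac)
  also have "\<dots> = 1"
    using N by (simp add: N_def sum_pmf_eq_1)
  finally have "tilted \<rho>' y \<le> N powr \<alpha>"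
    using N by (simp add: field_simps)
  then have "tilted \<rho>' y powr (1 + \<rho>') \<le> (N powr \<alpha>) powr (1 + \<rho>')"
    using assms tilted_nonneg by (intro powr_mono2) auto
  then show ?thesis
    using assms by (simp add: powr_powr \<alpha>_def N_def)
qed

lemma E0_mono: "0 \<le> \<rho> \<Longrightarrow> \<rho> \<le> \<rho>' \<Longrightarrow> E0 W p \<rho> \<le> E0 W p \<rho>'"
  unfolding E0_eq
  by (simp add: sum_tilted_pos sum_mono tilted_powr_antimono)

section \<open>Derivatives with respect to \<rho>\<close>

definition tilted' :: "real \<Rightarrow> 'y \<Rightarrow> real" where
  "tilted' \<rho> y = (\<Sum>x\<in>UNIV. pmf p x *
     (pmf (W x) y powr (1 / (1 + \<rho>)) * ln (pmf (W x) y) * (- 1 / (1 + \<rho>)\<^sup>2)))"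

text \<open>At \<open>a = 0\<close> the function and the formula both vanish, since
  \<open>0 powr b = 0\<close>; this admits transition probabilities equal to 0.\<close>

lemma powr_inverse_deriv:
  fixes a \<rho> :: real
  assumes "0 \<le> a" "-1 < \<rho>"
  shows "((\<lambda>\<rho>. a powr (1 / (1 + \<rho>))) has_real_derivative
    a powr (1 / (1 + \<rho>)) * ln a * (- 1 / (1 + \<rho>)\<^sup>2)) (at \<rho>)"
proof (cases "a = 0")
  case False
  have "((\<lambda>\<rho>. 1 / (1 + \<rho>)) has_real_derivative - 1 / (1 + \<rho>)\<^sup>2) (at \<rho>)"
    using assms by (auto intro!: derivative_eq_intros simp: power2_eq_square)
  from DERIV_powr[OF DERIV_const _ this, of a] False assms show ?thesis
    by simp
qed auto

lemma tilted_deriv: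
  "-1 < \<rho> \<Longrightarrow> ((\<lambda>\<rho>. tilted \<rho> y) has_real_derivative tilted' \<rho> y) (at \<rho>)"
  unfolding tilted_def tilted'_def
  by (intro DERIV_sum DERIV_cmult powr_inverse_deriv) auto

lemma tilted'_differentiable:
  assumes "-1 < \<rho>"
  shows "(\<lambda>\<rho>. tilted' \<rho> y) differentiable (at \<rho>)"
proof -
  have 1: "(\<lambda>\<rho>. pmf (W x) y powr (1 / (1 + \<rho>))) differentiable (at \<rho>)" for x
    by (rule differentiableI[OF has_field_derivative_imp_has_derivative[OF powr_inverse_deriv[OF pmf_nonneg assms]]])
  have "((\<lambda>\<rho>. - 1 / (1 + \<rho>)\<^sup>2) has_real_derivative 2 / (1 + \<rho>) ^ 3) (at \<rho>)"
    using assms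
    by (auto intro!: derivative_eq_intros simp: divide_simps power2_eq_square power3_eq_cube)
  then have 2: "(\<lambda>\<rho>. - 1 / (1 + \<rho>)\<^sup>2) differentiable (at \<rho>)"
    by (rule differentiableI[OF has_field_derivative_imp_has_derivative])
  show ?thesis
    unfolding tilted'_def
    by (intro differentiable_sum ballI differentiable_mult[OF differentiable_const]
        differentiable_mult[OF differentiable_mult[OF 1 differentiable_const] 2] finite)
qed

definition term' :: "real \<Rightarrow> 'y \<Rightarrow> real" where
  "term' \<rho> y = tilted \<rho> y powr (1 + \<rho>) *
     (ln (tilted \<rho> y) + (1 + \<rho>) * (tilted' \<rho> y / tilted \<rho> y))"

lemma term_deriv:
  assumes "-1 < \<rho>"
  shows "((\<lambda>\<rho>. tilted \<rho> y powr (1 + \<rho>)) has_real_derivative term' \<rho> y) (at \<rho>)"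
proof (cases "output_prob y = 0")
  case True
  then have "tilted \<rho> y = 0" for \<rho> by (simp add: tilted_eq_0_iff)
  then show ?thesis by (simp add: term'_def)
next
  case False
  then have "0 < tilted \<rho> y"
    using tilted_nonneg[of \<rho> y] tilted_eq_0_iff[of \<rho> y] by simp
  then show ?thesis
    using DERIV_powr[OF tilted_deriv[OF assms] _ DERIV_add[OF DERIV_const DERIV_ident], of y 1]
    by (simp add: term'_def mult.commute)
qed

lemma term'_differentiable:
  assumes "-1 < \<rho>"
  shows "(\<lambda>\<rho>. term' \<rho> y) differentiable (at \<rho>)"
proof (cases "output_prob y = 0")
  case True
  then have "tilted \<rho> y = 0" for \<rho> by (simp add: tilted_eq_0_iff)
  then show ?thesis by (simp add: term'_def)
next
  case False
  then have pos: "0 < tilted \<rho> y"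
    using tilted_nonneg[of \<rho> y] tilted_eq_0_iff[of \<rho> y] by simp
  have 1: "(\<lambda>\<rho>. tilted \<rho> y powr (1 + \<rho>)) differentiable (at \<rho>)"
    by (rule differentiableI[OF has_field_derivative_imp_has_derivative[OF term_deriv[OF assms]]])
  have 2: "(\<lambda>\<rho>. tilted \<rho> y) differentiable (at \<rho>)"
    by (rule differentiableI[OF has_field_derivative_imp_has_derivative[OF tilted_deriv[OF assms]]])
  have 3: "(\<lambda>\<rho>. ln (tilted \<rho> y)) differentiable (at \<rho>)"
    by (rule differentiableI[OF has_field_derivative_imp_has_derivative[OF
          DERIV_chain2[OF DERIV_ln[OF pos] tilted_deriv[OF assms]]]])
  show ?thesis
    unfolding term'_def using pos
    by (intro differentiable_mult[OF 1] differentiable_add[OF 3]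
        differentiable_mult[OF differentiable_add[OF differentiable_const differentiable_ident]]
        differentiable_divide[OF tilted'_differentiable[OF assms] 2]) auto
qed

text \<open>At \<rho> = 0 an output with probability q > 0 contributes
  \<open>q * ln q + tilted' 0 y\<close>, which is minus q times its divergence. Hence Gallager's
  function has slope \<open>mutual_info W p\<close> at 0.\<close>

lemma sum_term'_0: "(\<Sum>y\<in>UNIV. term' 0 y) = - mutual_info W p"
proof -
  have "term' 0 y = - (output_prob y * divergence y)" for y
  proof (cases "output_prob y = 0")
    case True
    then show ?thesis by (simp add: term'_def tilted_0)
  next
    case False
    then have q: "0 < output_prob y" using output_prob_nonneg[of y] by simp
    have "output_prob y * divergence y
        = (\<Sum>x\<in>UNIV. pmf p x * (pmf (W x) y * ln (pmf (W x) y)) - pmf p x * pmf (W x) y * ln (output_prob y))"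
      unfolding output_prob_times_divergence
    proof (intro sum.cong refl)
      fix x
      show "pmf p x * pmf (W x) y * ln (pmf (W x) y / output_prob y)
        = pmf p x * (pmf (W x) y * ln (pmf (W x) y)) - pmf p x * pmf (W x) y * ln (output_prob y)"
        using q by (cases "pmf (W x) y = 0") (auto simp: ln_div algebra_simps)
    qed
    also have "\<dots> = - tilted' 0 y - output_prob y * ln (output_prob y)"
      by (simp add: sum_subtractf tilted'_def output_prob_def sum_distrib_right sum_negf)
    finally show ?thesis
      using q by (simp add: term'_def tilted_0 algebra_simps)
  qed
  then show ?thesis
    by (simp add: sum_negf output_prob_times_divergence mutual_info_eq)
qed

end

text \<open>Gallager's function is \<open>- ln F\<close> with \<open>F 0 = 1\<close>,
  \<open>F' 0 = - mutual_info W p\<close> and \<open>F'\<close> differentiable at 0, so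
  \<open>second_order_limit\<close> applies. The value of \<open>L\<close> can stay implicit because
  the constant \<open>K\<close> built from it cancels in the ratio.\<close>

lemma E0_expansion:
  fixes W :: "'x::finite \<Rightarrow> 'y::finite pmf" and p :: "'x pmf"
  shows "\<exists>L. ((\<lambda>\<rho>. (mutual_info W p * \<rho> - E0 W p \<rho>) / \<rho>\<^sup>2) \<longlongrightarrow> L) (at_right 0)"
proof -
  define F where "F \<rho> = (\<Sum>y\<in>UNIV. tilted W p \<rho> y powr (1 + \<rho>))" for \<rho>
  define F' where "F' \<rho> = (\<Sum>y\<in>UNIV. term' W p \<rho> y)" for \<rho>
  have F_pos: "0 < F \<rho>" if "-1 < \<rho>" for \<rho>
    unfolding F_def by (rule sum_tilted_pos[OF that])
  have F: "(F has_real_derivative F' \<rho>) (at \<rho>)" if "-1 < \<rho>" for \<rho>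
    unfolding F_def F'_def by (intro DERIV_sum term_deriv that)
  have "E0 W p = (\<lambda>\<rho>. - ln (F \<rho>))"
    by (rule ext) (simp only: E0_eq F_def)
  then have deriv: "(E0 W p has_real_derivative - (1 / F \<rho> * F' \<rho>)) (at \<rho>)" if "0 \<le> \<rho>" for \<rho>
    using DERIV_minus[OF DERIV_chain2[OF DERIV_ln_divide[OF F_pos] F], of \<rho>] that by simp
  have "F' differentiable (at 0)"
    unfolding F'_def by (intro differentiable_sum ballI term'_differentiable finite) auto
  then obtain D where D: "(F' has_real_derivative D) (at 0)"
    by (auto simp: real_differentiable_def)
  have "((\<lambda>\<rho>. F' \<rho> / F \<rho>) has_real_derivative (D * F 0 - F' 0 * F' 0) / (F 0 * F 0)) (at 0)"
    using F_pos[of 0] by (intro DERIV_divide D F) auto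
  from DERIV_minus[OF this]
  have D2: "((\<lambda>\<rho>. - (1 / F \<rho> * F' \<rho>)) has_real_derivative
      - ((D * F 0 - F' 0 * F' 0) / (F 0 * F 0))) (at 0)"
    by simp
  have "F 0 = 1"
    by (simp add: F_def tilted_0 sum_output_prob output_prob_nonneg)
  then have eq: "- (1 / F 0 * F' 0) = mutual_info W p"
    by (simp add: F'_def sum_term'_0)
  from second_order_limit[OF E0_0 deriv D2, unfolded eq] show ?thesis
    by (rule exI)
qed

subsection \<open>The ratio of the exponents\<close>

lemma E_Fc_rate_eq:
  assumes "0 < r"
  shows "E_Fc_rate W p \<gamma> r =
    (SUP \<rho>\<in>{0..1}. ereal (exponent_term (mutual_info W p) (E0 W p) \<gamma> r \<rho>))"
  using assms by (simp add: E_Fc_rate_def exponent_term_def)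

text \<open>At rate 0 the penalty is infinite for every \<rho> > 0, while \<rho> = 0 gives the value
  0.\<close>

lemma E_Fc_rate_0:
  assumes "0 < \<gamma>" "0 < mutual_info W p"
  shows "E_Fc_rate W p \<gamma> 0 \<le> 0"
  unfolding E_Fc_rate_def
proof (rule SUP_least)
  fix \<rho> :: real
  assume \<rho>: "\<rho> \<in> {0..1}"
  show "ereal ((1 - 0) * mutual_info W p) * (- (ereal \<rho> * (ereal \<gamma> / ereal 0)) +
      ereal (E0 W p \<rho> / mutual_info W p * (1 - (1 + 0) / 2 * E0 W p \<rho>))) \<le> 0"
    using \<rho> assms by (cases "\<rho> = 0") (auto simp: E0_0 divide_ereal_def zero_ereal_def[symmetric])
qed

theorem theorem4:
  fixes W :: "'x::finite \<Rightarrow> 'y::finite pmf"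
    and p :: "'x pmf"
  assumes "symmetric_channel W"
    and "mutual_info W p > 0"
  shows "((\<lambda>\<gamma>. E_Fcs W p \<gamma> / E_Fc W p \<gamma>) \<longlongrightarrow> (1::ereal)) (at 1 within {0..1})"
proof -
  obtain L where L: "((\<lambda>\<rho>. (mutual_info W p * \<rho> - E0 W p \<rho>) / \<rho>\<^sup>2) \<longlongrightarrow> L) (at_right 0)"
    using E0_expansion by blast
  interpret second_order_expansion "mutual_info W p" L "E0 W p"
    using assms(2) L by unfold_locales (auto intro: E0_le E0_mono simp: E0_0)
  define I where "I = mutual_info W p"
  define K where "K = L / I + I"
  have I: "0 < I" using I_pos by (simp add: I_def)
  have K: "0 < K"
    using L_nonneg I by (simp add: K_def add_nonneg_pos)
  \<comment> \<open>The bound by 1 holds because the rate \<open>s\<close> takes part in the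
    supremum. For the bound by \<open>c\<close>, the estimates of both exponents share the factor
    \<open>M * I / 4\<close>, so only their constants remain in the quotient.\<close>
  have ratio: "\<forall>\<^sub>F \<gamma> in at_left 1. ereal c \<le> E_Fcs W p \<gamma> / E_Fc W p \<gamma> \<and> E_Fcs W p \<gamma> / E_Fc W p \<gamma> \<le> 1"
    if c: "0 < c" "c < 1" for c
  proof -
    \<comment> \<open>\<open>k1\<close> and \<open>k2\<close> enclose \<open>K\<close> strictly and
      have quotient \<open>c\<close>.\<close>
    define k1 where "k1 = K * (2 * c / (1 + c))"
    define k2 where "k2 = K * (2 / (1 + c))"
    have frac: "2 * c / (1 + c) < 1" "1 < 2 / (1 + c)"
      using c by simp_all
    have k1: "0 < k1" "k1 < K"
      using c K mult_strict_left_mono[OF frac(1) K] by (simp_all add: k1_def)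
    have k2: "K < k2"
      using mult_strict_left_mono[OF frac(2) K] by (simp add: k2_def)
    have k12: "k1 / k2 = c"
      using c K by (simp add: k1_def k2_def)
    have "\<forall>\<^sub>F \<gamma> in at_left 1. \<forall>r\<in>{\<gamma>..1}. \<forall>\<rho>\<in>{0..1}.
        exponent_term I (E0 W p) \<gamma> r \<rho> \<le> (1 - r) * (1 - \<gamma> / r)\<^sup>2 * (I / (4 * k1))"
      using exponent_term_upper[folded I_def, folded K_def, OF k1] .
    moreover have "\<forall>\<^sub>F \<gamma> in at_left 1. \<forall>r\<in>{\<gamma><..1}. \<exists>\<rho>\<in>{0..1}.
        (1 - r) * (1 - \<gamma> / r)\<^sup>2 * (I / (4 * k2)) \<le> exponent_term I (E0 W p) \<gamma> r \<rho>"
      using exponent_term_lower[folded I_def, folded K_def, OF k2] .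
    moreover have "\<forall>\<^sub>F \<gamma> in at_left (1::real). \<gamma> \<in> {0<..<1}"
      by (rule eventually_at_left_real) simp
    ultimately show ?thesis
    proof eventually_elim
      case (elim \<gamma>)
      define s where "s = (sqrt (\<gamma>\<^sup>2 + 8 * \<gamma>) - \<gamma>) / 2"
      define M where "M = (1 - s) * (1 - \<gamma> / s)\<^sup>2"
      have \<gamma>: "0 < \<gamma>" "\<gamma> < 1" using elim by auto
      have s: "\<gamma> < s" "s < 1"
        using rate_properties[OF \<gamma>] by (simp_all add: s_def)
      have M: "0 < M"
        using s \<gamma> by (simp add: M_def)
      have "E_Fc_rate W p \<gamma> r \<le> ereal (M * (I / (4 * k1)))" if r: "r \<in> {0..1}" for r
      proof -
        have nonneg: "0 \<le> ereal (M * (I / (4 * k1)))"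
          using M I k1 by simp
        \<comment> \<open>Rate 0 and rates below \<gamma> give at most 0; from \<gamma> on,
          \<open>rate_optimal\<close> bounds the rate-dependent factor by its value \<open>M\<close>
          at \<open>s\<close>.\<close>
        consider "r = 0" | "0 < r" "r < \<gamma>" | "\<gamma> \<le> r" using r by fastforce
        then show ?thesis
        proof cases
          case 1
          then show ?thesis
            using order_trans[OF E_Fc_rate_0[OF \<gamma>(1) I_pos] nonneg] by simp
        next
          case 2
          have "E_Fc_rate W p \<gamma> r \<le> 0"
            unfolding E_Fc_rate_eq[OF 2(1)]
            using 2 r by (intro SUP_least) (simp add: exponent_term_nonpos)
          from this nonneg show ?thesis by (rule order_trans)
        next
          case 3
          then have "0 < r" using \<gamma> by simp
          have "(1 - r) * (1 - \<gamma> / r)\<^sup>2 * (I / (4 * k1)) \<le> M * (I / (4 * k1))"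
            unfolding M_def s_def using rate_optimal[OF \<gamma> 3] r I k1
            by (intro mult_right_mono) auto
          then have "exponent_term I (E0 W p) \<gamma> r \<rho> \<le> M * (I / (4 * k1))" if "\<rho> \<in> {0..1}" for \<rho>
            using elim 3 r that by (meson atLeastAtMost_iff order_trans)
          then show ?thesis
            unfolding E_Fc_rate_eq[OF \<open>0 < r\<close>] by (intro SUP_least) (simp add: I_def)
        qed
      qed
      then have upper: "E_Fc W p \<gamma> \<le> ereal (M * (I / (4 * k1)))"
        unfolding E_Fc_def by (intro SUP_least)
      obtain \<rho> where \<rho>: "\<rho> \<in> {0..1}" "M * (I / (4 * k2)) \<le> exponent_term I (E0 W p) \<gamma> s \<rho>"
        using elim s unfolding M_def by (meson greaterThanAtMost_iff less_imp_le)
      have s0: "0 < s" using s \<gamma> by simp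
      have "ereal (M * (I / (4 * k2))) \<le> ereal (exponent_term I (E0 W p) \<gamma> s \<rho>)"
        using \<rho> by simp
      also have "\<dots> \<le> E_Fcs W p \<gamma>"
        unfolding E_Fcs_def s_def[symmetric] E_Fc_rate_eq[OF s0] I_def
        using \<rho>(1) by (rule SUP_upper)
      finally have lower: "ereal (M * (I / (4 * k2))) \<le> E_Fcs W p \<gamma>" .
      have le: "E_Fcs W p \<gamma> \<le> E_Fc W p \<gamma>"
        unfolding E_Fcs_def E_Fc_def s_def[symmetric] using s s0 by (intro SUP_upper) auto
      \<comment> \<open>Both exponents lie between two reals, so the quotient becomes a real
        one.\<close>
      obtain b where b: "E_Fc W p \<gamma> = ereal b"
        using upper le lower by (cases "E_Fc W p \<gamma>") auto
      obtain a where a: "E_Fcs W p \<gamma> = ereal a"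
        using upper le lower b by (cases "E_Fcs W p \<gamma>") auto
      have bounds: "M * (I / (4 * k2)) \<le> a" "a \<le> b" "b \<le> M * (I / (4 * k1))"
        using lower le upper a b by simp_all
      have "0 < M * (I / (4 * k2))"
        using M I K k2 by simp
      then have pos: "0 < a" "0 < b" using bounds by simp_all
      have "c * b \<le> k1 / k2 * (M * (I / (4 * k1)))"
        using bounds(3) c by (simp only: k12) (intro mult_left_mono, auto)
      also have "\<dots> = M * (I / (4 * k2))"
        using k1 by simp
      also have "\<dots> \<le> a" by (fact bounds)
      finally have "c \<le> a / b" "a / b \<le> 1"
        using pos bounds by (simp_all add: field_simps)
      then show ?case
        using pos by (simp add: a b one_ereal_def)
    qed
  qed
  \<comment> \<open>Inside the neighbourhood \<open>{0<..}\<close> of 1 and without the point 1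
    itself, \<open>{0..1}\<close> is a left neighbourhood.\<close>
  have within: "at (1::real) within {0..1} = at_left 1"
    by (intro at_within_nhd[of _ "{0<..}"]) auto
  show ?thesis
    unfolding within
  proof (rule order_tendstoI)
    fix a :: ereal assume "a < 1"
    \<comment> \<open>\<open>a\<close> may be negative or minus infinity; the maximum with 0 forces
      the intermediate real \<open>c\<close> into (0, 1).\<close>
    then have "max a 0 < ereal 1" by (simp add: one_ereal_def)
    then obtain c where c: "max a 0 < ereal c" "ereal c < ereal 1"
      using ereal_dense2 by blast
    then have "0 < c" "c < 1" by (auto simp: zero_ereal_def)
    from ratio[OF this] show "\<forall>\<^sub>F \<gamma> in at_left 1. a < E_Fcs W p \<gamma> / E_Fc W p \<gamma>"
    proof (rule eventually_mono)
      fix \<gamma>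
      have "a < ereal c" using c by simp
      moreover assume "ereal c \<le> E_Fcs W p \<gamma> / E_Fc W p \<gamma> \<and> E_Fcs W p \<gamma> / E_Fc W p \<gamma> \<le> 1"
      ultimately show "a < E_Fcs W p \<gamma> / E_Fc W p \<gamma>"
        by (blast intro: less_le_trans)
    qed
  next
    fix a :: ereal
    assume a: "1 < a"
    have "\<forall>\<^sub>F \<gamma> in at_left 1. E_Fcs W p \<gamma> / E_Fc W p \<gamma> \<le> 1"
      using ratio[of "1 / 2"] by (simp add: eventually_conj_iff)
    then show "\<forall>\<^sub>F \<gamma> in at_left 1. E_Fcs W p \<gamma> / E_Fc W p \<gamma> < a"
      by (rule eventually_mono) (rule le_less_trans[OF _ a])
  qed
qed

end
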